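(* Let $(X, D, P)$ be a nonempty complete perturbed metric space, let $F : \mathbb{R}_+ \to \mathbb{R}$ be a function satisfying (F1), (F2) and (F3), and let $T : X \to X$ be a perturbed continuous $F$-perturbed mapping. Then $T$ has a unique fixed point in $X$.
   Context: Perturbed metric space: let $X$ be a set and $D, P : X \times X \to [0,\infty)$ two mappings. $D$ is a perturbed metric on $X$ with respect to $P$ if $d = D - P : X \times X \to \mathbb{R}$, $d(x,y) = D(x,y) - P(x,y)$, is a metric on $X$. Then $(X, D, P)$ is called a perturbed metric space and $d$ is called the exact metric. No further condition is imposed on $D$ or $P$. $(X, D, P)$ is a complete perturbed metric space if $(X, d)$ is a complete metric space. A mapping $T : X \to X$ is perturbed continuous if it is continuous with respect to the exact metric $d$. Here $\mathbb{R}_+ = (0,\infty)$. The conditions on $F : \mathbb{R}_+ \to \mathbb{R}$ are: (F1) $F$ is strictly increasing, i.e. for all $t_1, t_2 \in \mathbb{R}_+$, $t_1 < t_2$ implies $F(t_1) < F(t_2)$; (F2) for each sequence $\{t_n\}_{n\in\mathbb{N}}$ of positive real numbers, $\lim_{n\to\infty} t_n = 0$ if and only if $\lim_{n\to\infty} F(t_n) = -\infty$; (F3) there exists $k \in (0,1)$ such that $\lim_{t \to 0^+} t^k F(t) = 0$. A mapping $T : X \to X$ is an $F$-perturbed mapping if there exists $\tau > 0$ such that for all $x, y \in X$, $$D(Tx, Ty) > 0 \implies \tau + F(D(Tx,Ty)) \le F(D(x,y)).$$ *)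

theory Defs
  imports "HOL-Analysis.Analysis"
begin

text \<open>
  The locale \<^locale>\<open>Metric_space\<close> asks for nonnegativity and symmetry of the distance on
  the whole type, not just on the carrier. The paper's maps live on \<open>X \<times> X\<close> only, so the exact
  metric is set to \<open>0\<close> off \<open>X \<times> X\<close>; hence no condition is put on \<open>D\<close> and \<open>P\<close> there.
\<close>

definition exact_metric :: "'a set \<Rightarrow> ('a \<Rightarrow> 'a \<Rightarrow> real) \<Rightarrow> ('a \<Rightarrow> 'a \<Rightarrow> real) \<Rightarrow> 'a \<Rightarrow> 'a \<Rightarrow> real"
  where "exact_metric X D P x y = (if x \<in> X \<and> y \<in> X then D x y - P x y else 0)"

definition perturbed_metric_space :: "'a set \<Rightarrow> ('a \<Rightarrow> 'a \<Rightarrow> real) \<Rightarrow> ('a \<Rightarrow> 'a \<Rightarrow> real) \<Rightarrow> bool"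
  where "perturbed_metric_space X D P \<longleftrightarrow>
    (\<forall>x\<in>X. \<forall>y\<in>X. 0 \<le> D x y \<and> 0 \<le> P x y) \<and> Metric_space X (exact_metric X D P)"

definition complete_perturbed_metric_space ::
    "'a set \<Rightarrow> ('a \<Rightarrow> 'a \<Rightarrow> real) \<Rightarrow> ('a \<Rightarrow> 'a \<Rightarrow> real) \<Rightarrow> bool"
  where "complete_perturbed_metric_space X D P \<longleftrightarrow>
    perturbed_metric_space X D P \<and> Metric_space.mcomplete X (exact_metric X D P)"

definition perturbed_continuous ::
    "'a set \<Rightarrow> ('a \<Rightarrow> 'a \<Rightarrow> real) \<Rightarrow> ('a \<Rightarrow> 'a \<Rightarrow> real) \<Rightarrow> ('a \<Rightarrow> 'a) \<Rightarrow> bool"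
  where "perturbed_continuous X D P T \<longleftrightarrow>
    continuous_map (Metric_space.mtopology X (exact_metric X D P))
                   (Metric_space.mtopology X (exact_metric X D P)) T"

text \<open>
  A function \<open>(0,\<infinity>) \<rightarrow> \<real>\<close> is represented by a total function of type \<^typ>\<open>real \<Rightarrow> real\<close>. The
  conditions \<open>F1\<close>, \<open>F2\<close>, \<open>F3\<close> involve only its values at positive arguments.
\<close>

definition F1 :: "(real \<Rightarrow> real) \<Rightarrow> bool"
  where "F1 F \<longleftrightarrow> strict_mono_on {0<..} F"

definition F2 :: "(real \<Rightarrow> real) \<Rightarrow> bool"
  where "F2 F \<longleftrightarrow> (\<forall>t::nat \<Rightarrow> real. (\<forall>n. 0 < t n) \<longrightarrow>
    (t \<longlonglongrightarrow> 0 \<longleftrightarrow> filterlim (\<lambda>n. F (t n)) at_bot sequentially))"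

definition F3 :: "(real \<Rightarrow> real) \<Rightarrow> bool"
  where "F3 F \<longleftrightarrow> (\<exists>k. 0 < k \<and> k < 1 \<and> ((\<lambda>t. t powr k * F t) \<longlongrightarrow> 0) (at_right 0))"

text \<open>
  \<open>D x y = 0\<close> with \<open>D (T x) (T y) > 0\<close> is possible only for \<open>x = y\<close>. There the paper's \<open>F (D x y)\<close>
  is undefined, and the inequality below refers to \<open>F 0\<close>. Since \<open>F 0\<close> is subject to no
  assumption, reading the paper's inequality as also asserting \<open>D x y > 0\<close> only adds to the
  hypothesis.
\<close>

definition F_perturbed_mapping ::
    "'a set \<Rightarrow> ('a \<Rightarrow> 'a \<Rightarrow> real) \<Rightarrow> (real \<Rightarrow> real) \<Rightarrow> ('a \<Rightarrow> 'a) \<Rightarrow> bool"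
  where "F_perturbed_mapping X D F T \<longleftrightarrow> (\<exists>\<tau>>0. \<forall>x\<in>X. \<forall>y\<in>X.
    0 < D (T x) (T y) \<longrightarrow> \<tau> + F (D (T x) (T y)) \<le> F (D x y))"

end

theory Submission
  imports Defs "HOL-Real_Asymp.Real_Asymp"
begin

text \<open>
  Off the diagonal \<open>D\<close> dominates the exact metric, hence is positive. If no Picard iterate is
  fixed, the steps \<open>t n = D (x n) (x (Suc n))\<close> satisfy \<open>F (t n) \<le> F (t 0) - n \<tau>\<close>, so \<open>t\<close> tends
  to \<open>0\<close> by \<open>F2\<close>, and multiplying by \<open>t n powr k\<close> gives \<open>n * t n powr k \<longlonglongrightarrow> 0\<close> by \<open>F3\<close>. Thus
  \<open>t n \<le> n powr (- 1 / k)\<close> eventually, a summable bound, and the iterates form a Cauchy sequence.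
\<close>

lemma summable_if_F_decreases:
  fixes t :: "nat \<Rightarrow> real"
  assumes F2: "F2 F" and F3: "F3 F" and pos: "\<And>n. 0 < t n" and "0 < \<tau>"
    and step: "\<And>n. \<tau> + F (t (Suc n)) \<le> F (t n)"
  shows "summable t"
proof -
  have F_le: "F (t n) \<le> F (t 0) - real n * \<tau>" for n
  proof (induction n)
    case (Suc n)
    with step[of n] show ?case by (simp add: algebra_simps)
  qed simp
  have "filterlim (\<lambda>n. F (t n)) at_bot sequentially"
  proof (rule filterlim_at_bot_mono)
    show "filterlim (\<lambda>n. F (t 0) - real n * \<tau>) at_bot sequentially"
      using \<open>0 < \<tau>\<close> by real_asymp
  qed (use F_le in auto)
  \<comment> \<open>\<open>F2\<close> is read from right to left: divergence of
    \<open>F (t n)\<close> to minus infinity forces \<open>t\<close> to \<open>0\<close>.\<close>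
  with F2 pos have t0: "t \<longlonglongrightarrow> 0" by (auto simp: F2_def)
  \<comment> \<open>The limit in \<open>F3\<close> is one-sided, so composing it with
    \<open>t\<close> needs an approach to \<open>0\<close> through positive values.\<close>
  then have t_right: "filterlim t (at_right 0) sequentially"
    using pos by (auto simp: filterlim_at less_imp_neq[THEN not_sym])
  obtain k where k: "0 < k" "k < 1" and lim: "((\<lambda>u. u powr k * F u) \<longlongrightarrow> 0) (at_right 0)"
    using F3 by (auto simp: F3_def)
  have "(\<lambda>n. t n powr k * F (t n)) \<longlonglongrightarrow> 0"
    using filterlim_compose[OF lim t_right] .
  moreover have pow0: "(\<lambda>n. t n powr k) \<longlonglongrightarrow> 0"
    using tendsto_powr'[OF t0 tendsto_const, of k] k pos by (auto simp: less_imp_le)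
  ultimately have "(\<lambda>n. t n powr k * F (t 0) - t n powr k * F (t n)) \<longlonglongrightarrow> 0"
    using tendsto_diff[OF tendsto_mult_left_zero] by fastforce
  \<comment> \<open>By \<open>F_le\<close>, this difference is at least
    \<open>t n powr k * (real n * \<tau>)\<close>. The threshold \<open>\<tau>\<close> cancels,
    leaving \<open>t n powr k \<le> 1 / real n\<close>.\<close>
  then have "\<forall>\<^sub>F n in sequentially. t n powr k * F (t 0) - t n powr k * F (t n) < \<tau>"
    using \<open>0 < \<tau>\<close> by (rule order_tendstoD)
  then have "\<forall>\<^sub>F n in sequentially. norm (t n) \<le> real n powr (- 1 / k)"
    \<comment> \<open>The index \<open>0\<close> must be excluded: \<open>0 powr (- 1 / k)\<close>
      is \<open>0\<close>, which does not bound \<open>t 0\<close>.\<close>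
    using eventually_gt_at_top[of 0]
  proof eventually_elim
    case (elim n)
    have "t n powr k * (real n * \<tau>) \<le> t n powr k * (F (t 0) - F (t n))"
      using F_le[of n] by (intro mult_left_mono) auto
    also have "\<dots> < \<tau>" using elim by (simp add: algebra_simps)
    finally have "t n powr k \<le> 1 / real n"
      using elim \<open>0 < \<tau>\<close> by (simp add: field_simps)
    then have "(t n powr k) powr (1 / k) \<le> (1 / real n) powr (1 / k)"
      using k by (intro powr_mono2) auto
    with k pos[of n] elim show ?case
      by (simp add: powr_powr powr_divide powr_minus_divide)
  qed
  \<comment> \<open>Since \<open>k < 1\<close>, the exponent \<open>- 1 / k\<close> lies below
    \<open>-1\<close>.\<close>
  moreover have "summable (\<lambda>n. real n powr (- 1 / k))"
    using k by (simp add: summable_real_powr_iff field_simps)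
  ultimately show ?thesis by (rule summable_comparison_test_ev)
qed

context Metric_space
begin

lemma mdist_le_sum:
  assumes "range x \<subseteq> M" "m \<le> n"
  shows "d (x m) (x n) \<le> (\<Sum>i=m..<n. d (x i) (x (Suc i)))"
  using \<open>m \<le> n\<close>
proof (induction n rule: dec_induct)
  case base
  have "x m \<in> M" using assms by blast
  then show ?case by simp
next
  case (step n)
  have "d (x m) (x (Suc n)) \<le> d (x m) (x n) + d (x n) (x (Suc n))"
    using assms(1) by (intro triangle) auto
  with step show ?case by simp
qed

text \<open>Iterating the triangle inequality bounds \<open>d (x m) (x n)\<close> by a block of the
  series, and such blocks are small by the Cauchy criterion.\<close>

lemma MCauchy_if_summable:
  assumes "range x \<subseteq> M" and "summable (\<lambda>n. d (x n) (x (Suc n)))"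
  shows "MCauchy x"
  unfolding MCauchy_def
proof (intro conjI allI impI)
  fix \<epsilon> :: real
  assume "0 < \<epsilon>"
  with assms(2) obtain N
    where N: "\<And>m n. m \<ge> N \<Longrightarrow> norm (\<Sum>i=m..<n. d (x i) (x (Suc i))) < \<epsilon>"
    unfolding summable_Cauchy by blast
  have *: "d (x m) (x n) < \<epsilon>" if "N \<le> m" "m \<le> n" for m n
    using mdist_le_sum[OF assms(1) that(2)] N[OF that(1), of n] by simp
  show "\<exists>N. \<forall>n n'. N \<le> n \<longrightarrow> N \<le> n' \<longrightarrow> d (x n) (x n') < \<epsilon>"
    by (metis * commute nle_le)
qed (fact assms(1))

text \<open>The shifted orbit converges to the limit \<open>x\<close> of the orbit and, by
  continuity, to \<open>T x\<close>; limits in a metric space are unique.\<close>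

lemma fixed_point_if_orbit_MCauchy:
  assumes "mcomplete" and cont: "continuous_map mtopology mtopology T"
    and "MCauchy (\<lambda>n. (T ^^ n) a)"
  obtains x where "x \<in> M" "T x = x"
proof -
  obtain x where x: "limitin mtopology (\<lambda>n. (T ^^ n) a) x sequentially"
    using assms unfolding mcomplete_def by blast
  have "limitin mtopology (\<lambda>n. (T ^^ Suc n) a) x sequentially"
    using limitin_sequentially_offset[OF x, of 1] by simp
  moreover have "limitin mtopology (\<lambda>n. (T ^^ Suc n) a) (T x) sequentially"
    using continuous_map_limit[OF cont x] by (simp add: o_def)
  ultimately have "T x = x"
    by (intro limitin_metric_unique) auto
  with x show thesis using that limitin_mspace by blast
qed

end

theorem theorem3p3:
  fixes X :: "'a set" and D P :: "'a \<Rightarrow> 'a \<Rightarrow> real"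
    and F :: "real \<Rightarrow> real" and T :: "'a \<Rightarrow> 'a"
  assumes "X \<noteq> {}"
    and "complete_perturbed_metric_space X D P"
    and "F1 F" and "F2 F" and "F3 F"
    and "T \<in> X \<rightarrow> X"
    and "perturbed_continuous X D P T"
    and "F_perturbed_mapping X D F T"
  shows "\<exists>!x. x \<in> X \<and> T x = x"
proof -
  define d where "d = exact_metric X D P"
  interpret Metric_space X d
    using assms(2)
    by (simp add: d_def complete_perturbed_metric_space_def perturbed_metric_space_def)
  have d_le: "d x y \<le> D x y" if "x \<in> X" "y \<in> X" for x y
    using assms(2) that
    by (simp add: d_def exact_metric_def complete_perturbed_metric_space_def
        perturbed_metric_space_def)
  have D_pos: "0 < D x y" if "x \<in> X" "y \<in> X" "x \<noteq> y" for x y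
    using d_le[OF that(1,2)] mdist_pos_less[OF that(3,1,2)] by simp
  obtain \<tau> where "0 < \<tau>"
    and contr: "\<And>x y. \<lbrakk>x \<in> X; y \<in> X; 0 < D (T x) (T y)\<rbrakk> \<Longrightarrow> \<tau> + F (D (T x) (T y)) \<le> F (D x y)"
    using assms(8) by (auto simp: F_perturbed_mapping_def)
  obtain a where "a \<in> X" using assms(1) by blast
  define x where "x n = (T ^^ n) a" for n
  have x_Suc: "x (Suc n) = T (x n)" for n by (simp add: x_def)
  have xX: "x n \<in> X" for n
  proof (induction n)
    case 0
    then show ?case using \<open>a \<in> X\<close> by (simp add: x_def)
  next
    case (Suc n)
    then show ?case using assms(6) by (auto simp: x_Suc)
  qed
  have "\<exists>z. z \<in> X \<and> T z = z"
  proof (cases "\<exists>n. T (x n) = x n")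
    case True
    then show ?thesis using xX by blast
  next
    case False
    \<comment> \<open>Positivity serves twice: it triggers the implication in \<open>contr\<close>,
      and it keeps the arguments of \<open>F\<close> where \<open>F2\<close> and \<open>F3\<close>
      speak about them.\<close>
    then have pos: "0 < D (x n) (x (Suc n))" for n
      using D_pos[OF xX xX] by (metis x_Suc)
    have "\<tau> + F (D (x (Suc n)) (x (Suc (Suc n)))) \<le> F (D (x n) (x (Suc n)))" for n
      using contr[OF xX xX, of n "Suc n"] pos[of "Suc n"] by (simp add: x_Suc)
    with assms(4,5) pos \<open>0 < \<tau>\<close> have "summable (\<lambda>n. D (x n) (x (Suc n)))"
      by (rule summable_if_F_decreases)
    \<comment> \<open>The triangle inequality is known for \<open>d\<close> but not for
      \<open>D\<close>, so summability is passed down to \<open>d\<close> before the Cauchy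
      argument.\<close>
    then have "summable (\<lambda>n. d (x n) (x (Suc n)))"
      by (rule summable_comparison_test') (use d_le xX in auto)
    then have "MCauchy x"
      using xX by (intro MCauchy_if_summable) auto
    moreover have "mcomplete" "continuous_map mtopology mtopology T"
      using assms(2,7)
      by (simp_all add: d_def complete_perturbed_metric_space_def perturbed_continuous_def)
    ultimately show ?thesis
      unfolding x_def by (metis fixed_point_if_orbit_MCauchy)
  qed
  moreover have "y = z" if "y \<in> X" "T y = y" "z \<in> X" "T z = z" for y z
  proof (rule ccontr)
    assume "y \<noteq> z"
    \<comment> \<open>At two distinct fixed points \<open>contr\<close> reads
      \<open>\<tau> + F (D y z) \<le> F (D y z)\<close>, which contradicts
      \<open>0 < \<tau>\<close>.\<close>
    with that D_pos contr[of y z] \<open>0 < \<tau>\<close> show False by fastforce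
  qed
  ultimately show ?thesis by blast
qed

end
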